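(* Let $k$ be a positive integer. A loopless graph $G$ of order $n$ has a bipartite modulo $k$-regular subgraph if $\chi(G)\le 2t$ (with $t$ a positive integer) and $$|E(G)|> \left(2-\frac{1}{t}\right)(q(k)-1)(n-1),$$ where $q(k)$ denotes the smallest prime power with $q(k)\ge k$. Consequently, if $|E(G)|> (2q(k)-\frac{5}{2})(n-1)$ or $|E(G)|> (4k-6)(n-1)$, then $G$ has a bipartite modulo $k$-regular subgraph.
   Context: Graphs may have multiple edges. The order of a graph is its number of vertices, $E(G)$ is its edge set, and $\chi(G)$ is its chromatic number. A modulo $k$-regular graph is a graph whose vertex degrees are positive and divisible by $k$; a subgraph need not be spanning.
   Formalization: The last claim, with |E(G)| > (4k-6)(n-1), additionally assumes that G has at least one edge: for k = 1 an edgeless graph with n ≥ 2 satisfies the bound but has no modulo 1-regular subgraph; for k ≥ 2 the bound already implies it. *)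

theory Defs
  imports Complex_Main "HOL-Number_Theory.Prime_Powers"
begin

text \<open>
  Undirected graphs with multiple edges. An edge is an element of \<open>edges\<close> and \<open>ends\<close> maps it to
  its set of end-vertices, so distinct edges may be parallel; a loop at \<open>v\<close> is an edge with
  \<open>ends e = {v}\<close>.
\<close>

record ('v, 'e) mgraph =
  vertices :: "'v set"
  edges :: "'e set"
  ends :: "'e \<Rightarrow> 'v set"

text \<open>
  Graphs are finite and have at least one vertex. Without the latter condition the graph with no
  vertices would vacuously be a bipartite modulo $k$-regular subgraph of every graph.
\<close>

definition graph :: "('v, 'e) mgraph \<Rightarrow> bool" where
  "graph G \<longleftrightarrow>
     finite (vertices G) \<and> vertices G \<noteq> {} \<and> finite (edges G) \<and>
     (\<forall>e\<in>edges G. ends G e \<subseteq> vertices G \<and> card (ends G e) \<in> {1, 2})"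

definition loopless :: "('v, 'e) mgraph \<Rightarrow> bool" where
  "loopless G \<longleftrightarrow> (\<forall>e\<in>edges G. card (ends G e) \<noteq> 1)"

definition order :: "('v, 'e) mgraph \<Rightarrow> nat" where
  "order G = card (vertices G)"

text \<open>The second summand makes a loop count twice.\<close>

definition degree :: "('v, 'e) mgraph \<Rightarrow> 'v \<Rightarrow> nat" where
  "degree G v = card {e \<in> edges G. v \<in> ends G e} + card {e \<in> edges G. ends G e = {v}}"

definition subgraph :: "('v, 'e) mgraph \<Rightarrow> ('v, 'e) mgraph \<Rightarrow> bool" where
  "subgraph H G \<longleftrightarrow>
     graph H \<and> vertices H \<subseteq> vertices G \<and> edges H \<subseteq> edges G \<and>
     (\<forall>e\<in>edges H. ends H e = ends G e)"

definition proper_colouring :: "('v, 'e) mgraph \<Rightarrow> nat \<Rightarrow> ('v \<Rightarrow> nat) \<Rightarrow> bool" where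
  "proper_colouring G c f \<longleftrightarrow>
     f ` vertices G \<subseteq> {..<c} \<and>
     (\<forall>e\<in>edges G. \<forall>u v. ends G e = {u, v} \<longrightarrow> f u \<noteq> f v)"

text \<open>Only meaningful for loopless graphs, since a graph with a loop has no proper colouring.\<close>

definition chromatic_number :: "('v, 'e) mgraph \<Rightarrow> nat" where
  "chromatic_number G = (LEAST c. \<exists>f. proper_colouring G c f)"

definition bipartite :: "('v, 'e) mgraph \<Rightarrow> bool" where
  "bipartite G \<longleftrightarrow>
     (\<exists>A B. A \<union> B = vertices G \<and> A \<inter> B = {} \<and>
       (\<forall>e\<in>edges G. \<exists>a\<in>A. \<exists>b\<in>B. ends G e = {a, b}))"

definition modulo_regular :: "nat \<Rightarrow> ('v, 'e) mgraph \<Rightarrow> bool" where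
  "modulo_regular k G \<longleftrightarrow> (\<forall>v\<in>vertices G. degree G v > 0 \<and> k dvd degree G v)"

definition has_bipartite_modulo_regular_subgraph :: "nat \<Rightarrow> ('v, 'e) mgraph \<Rightarrow> bool" where
  "has_bipartite_modulo_regular_subgraph k G \<longleftrightarrow>
     (\<exists>H. subgraph H G \<and> bipartite H \<and> modulo_regular k H)"

text \<open>\<^const>\<open>primepow\<close> requires a positive exponent, so 1 is not a prime power and
  \<open>least_primepow_ge 1 = 2\<close>.\<close>

definition least_primepow_ge :: "nat \<Rightarrow> nat" where
  "least_primepow_ge k = (LEAST r. primepow r \<and> k \<le> r)"

end

theory Submission
  imports Defs
begin

text \<open>
  Let \<open>q\<close> be a prime power. By Olson's theorem on zero-sum subsequences in the group \<open>(\<int>/q)\<^bsup>n-1\<^esup>\<close>, applied to the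
  incidence vectors of the edges with one coordinate omitted, a bipartite graph with more than
  \<open>(q - 1)(n - 1)\<close> edges has a nonempty set of edges all of whose degrees are divisible by \<open>q\<close>: in a
  bipartite graph the omitted degree is determined by the others. Splitting each vertex into vertices
  of degree \<open>q\<close> and removing \<open>q - k\<close> perfect matchings makes all degrees divisible by \<open>k\<close>.

  A graph coloured with \<open>2t\<close> colours has a bipartite subgraph containing a \<open>t / (2t - 1)\<close> fraction
  of the edges: average over the ways of placing \<open>t\<close> of the colours on one side. This gives the first
  claim. For the second, a graph with just over \<open>(2q - 5/2)(n - 1)\<close> edges, none of whose proper
  subgraphs is that dense, is \<open>(4q - 6)\<close>-degenerate, hence \<open>4(q - 1)\<close>-colourable, and the first claim
  applies with \<open>t = 2(q - 1)\<close>. For the third, a power of two lies between \<open>k\<close> and \<open>2k - 2\<close>.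
\<close>

section \<open>Subsets with all incidences divisible by a prime power\<close>

lemma alternating_binomial_sum:
  "(\<Sum>j\<le>m. (- 1) ^ j * int (Suc n choose j)) = (- 1) ^ m * int (n choose m)"
  by (induction m) (simp_all add: algebra_simps)

text \<open>Up to sign the sum is the binomial coefficient of \<open>x - 1\<close> over
  \<open>p ^ a - 1\<close>, and by absorption \<open>x\<close> times it is a multiple of
  \<open>p ^ a\<close>. Were it coprime to \<open>p\<close>, then \<open>p ^ a\<close> would divide
  \<open>x\<close>.\<close>

lemma prime_dvd_alternating_binomial_sum:
  assumes "prime (p::nat)" and "\<not> p ^ a dvd x"
  shows "int p dvd (\<Sum>j<p ^ a. (- 1) ^ j * int (x choose j))"
proof -
  obtain n where n: "x = Suc n"
    using assms(2) by (cases x) auto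
  obtain m where m: "p ^ a = Suc m"
    using assms(1) prime_gt_0_nat by (metis gr0_implies_Suc zero_less_power)
  have "p ^ a dvd x * (n choose m)"
    using Suc_times_binomial_eq[of n m] n m by (metis dvd_triv_right)
  with assms(2) have "\<not> coprime (p ^ a) (n choose m)"
    using coprime_dvd_mult_left_iff by blast
  with assms(1) have "p dvd n choose m"
    by (metis coprime_power_left_iff prime_imp_coprime)
  moreover have "(\<Sum>j<p ^ a. (- 1) ^ j * int (x choose j)) = (- 1) ^ m * int (n choose m)"
    unfolding n m lessThan_Suc_atMost by (rule alternating_binomial_sum)
  ultimately show ?thesis
    by simp
qed

text \<open>Integer-valued functions on a cube \<open>{0, 1}\<^sup>E\<close>, points being given by their supports, which are
  polynomials of degree at most \<open>d\<close>.\<close>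

inductive cube_poly :: "nat \<Rightarrow> ('a set \<Rightarrow> int) \<Rightarrow> bool" for d where
  monomial: "finite T \<Longrightarrow> card T \<le> d \<Longrightarrow> cube_poly d (\<lambda>S. c * of_bool (T \<subseteq> S))"
| add: "cube_poly d f \<Longrightarrow> cube_poly d g \<Longrightarrow> cube_poly d (\<lambda>S. f S + g S)"

lemma cube_poly_const: "cube_poly d (\<lambda>_. c)"
  using cube_poly.monomial[of "{}" d c] by simp

lemma cube_poly_sum:
  "(\<And>i. i \<in> I \<Longrightarrow> cube_poly d (f i)) \<Longrightarrow> cube_poly d (\<lambda>S. \<Sum>i\<in>I. f i S)"
  by (induction I rule: infinite_finite_induct) (auto intro: cube_poly_const cube_poly.add)

text \<open>Coordinates are idempotent on the cube, so the monomials of \<open>T\<close> and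
  \<open>U\<close> multiply to that of \<open>T \<union> U\<close>.\<close>

lemma cube_poly_mult_monomial:
  assumes "cube_poly d f" and "finite T" and "card T \<le> d'"
  shows "cube_poly (d' + d) (\<lambda>S. (c * of_bool (T \<subseteq> S)) * f S)"
  using assms(1)
proof induction
  case (monomial U c')
  have "card (T \<union> U) \<le> d' + d"
    using card_Un_le[of T U] monomial assms by linarith
  then have "cube_poly (d' + d) (\<lambda>S. (c * c') * of_bool (T \<union> U \<subseteq> S))"
    using monomial assms by (intro cube_poly.monomial) auto
  moreover have "(\<lambda>S. (c * of_bool (T \<subseteq> S)) * (c' * of_bool (U \<subseteq> S))) =
      (\<lambda>S. (c * c') * of_bool (T \<union> U \<subseteq> S))"
    by auto
  ultimately show ?case
    by simp
next
  case (add f g)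
  then show ?case
    using cube_poly.add[OF add.IH] by (simp add: distrib_left)
qed

lemma cube_poly_mult:
  assumes "cube_poly d f" and "cube_poly d' g"
  shows "cube_poly (d + d') (\<lambda>S. f S * g S)"
  using assms(1)
proof induction
  case (monomial T c)
  then show ?case
    using cube_poly_mult_monomial[OF assms(2)] by blast
next
  case (add f f')
  then show ?case
    using cube_poly.add[OF add.IH] by (simp add: distrib_right)
qed

lemma cube_poly_prod:
  assumes "finite I" and "\<And>i. i \<in> I \<Longrightarrow> cube_poly d (f i)"
  shows "cube_poly (card I * d) (\<lambda>S. \<Prod>i\<in>I. f i S)"
  using assms by (induction I) (auto intro: cube_poly_const cube_poly_mult)

text \<open>The binomial coefficient counts the \<open>j\<close>-subsets of \<open>A\<close>
  contained in \<open>S\<close>, so it is a sum of monomials of degree \<open>j\<close>.\<close>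

lemma cube_poly_binomial:
  assumes "finite A" and "j \<le> d"
  shows "cube_poly d (\<lambda>S. int (card (A \<inter> S) choose j))"
proof -
  let ?K = "{T. T \<subseteq> A \<and> card T = j}"
  have "cube_poly d (\<lambda>S. \<Sum>T\<in>?K. 1 * of_bool (T \<subseteq> S))"
    using assms by (intro cube_poly_sum cube_poly.monomial) (auto intro: finite_subset)
  moreover have "(\<Sum>T\<in>?K. 1 * of_bool (T \<subseteq> S)) = int (card (A \<inter> S) choose j)" for S
  proof -
    have "?K \<inter> {T. T \<subseteq> S} = {T. T \<subseteq> A \<inter> S \<and> card T = j}"
      by auto
    then show ?thesis
      using assms n_subsets[of "A \<inter> S" j] by (simp add: sum_of_bool_eq)
  qed
  ultimately show ?thesis
    by simp
qed

text \<open>A monomial of degree below \<open>card E\<close> misses some coordinate \<open>x\<close>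
  of \<open>E\<close>. Toggling \<open>x\<close> keeps its value and flips the sign, so the signed
  sum equals its own negative.\<close>

lemma cube_poly_alternating_sum:
  assumes "cube_poly d f" and "finite E" and "d < card E"
  shows "(\<Sum>S\<in>Pow E. (- 1) ^ card S * f S) = 0"
  using assms(1)
proof induction
  case (monomial T c)
  then obtain x where x: "x \<in> E" "x \<notin> T"
    using assms by (metis card_mono leD le_trans subsetI)
  have fin: "finite S" if "S \<subseteq> E" for S
    using that assms(2) finite_subset by auto
  let ?g = "\<lambda>S. (- 1) ^ card S * (c * of_bool (T \<subseteq> S)) :: int"
  let ?h = "\<lambda>S. if x \<in> S then S - {x} else insert x S"
  have "sum ?g (Pow E) = sum (\<lambda>S. - ?g S) (Pow E)"
  proof (rule sum.reindex_bij_witness[of _ ?h ?h])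
    fix S assume S: "S \<in> Pow E"
    show "- ?g (?h S) = ?g S"
    proof (cases "x \<in> S")
      case True
      then have "card S = Suc (card (S - {x}))"
        using fin S by (intro card.remove) auto
      then have "(- 1 :: int) ^ card S = - ((- 1) ^ card (S - {x}))"
        by simp
      with True x show ?thesis by auto
    next
      case False
      with fin S have "card (insert x S) = Suc (card S)"
        by auto
      with False x show ?thesis by auto
    qed
  qed (use x in auto)
  then show ?case
    by (simp add: sum_negf)
next
  case (add f g)
  then show ?case
    by (simp add: distrib_left sum.distrib)
qed

theorem exists_subset_all_dvd:
  assumes "finite E" and "finite I" and "primepow q" and "(q - 1) * card I < card E"
    and "\<And>i. i \<in> I \<Longrightarrow> A i \<subseteq> E"
  shows "\<exists>S\<subseteq>E. S \<noteq> {} \<and> (\<forall>i\<in>I. q dvd card (A i \<inter> S))"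
proof (rule ccontr)
  assume neg: "\<not> ?thesis"
  obtain p a where p: "prime p" and q: "q = p ^ a"
    using assms(3) by (auto simp: primepow_def)
  \<comment> \<open>For \<open>x > 0\<close>, \<open>P x\<close> is up to sign the binomial coefficient of \<open>x - 1\<close> over \<open>q - 1\<close>, a multiple of
    \<open>p\<close> unless \<open>q dvd x\<close>; but \<open>P 0 = 1\<close>. So \<open>F\<close> is 1 at the empty set and, if the theorem fails,
    divisible by \<open>p\<close> everywhere else, although its degree is too small for that.\<close>
  define P where "P x = (\<Sum>j<q. (- 1) ^ j * int (x choose j))" for x
  define F where "F S = (\<Prod>i\<in>I. P (card (A i \<inter> S)))" for S
  have q0: "q > 0"
    using assms(3) primepow_gt_0_nat by blast
  have "cube_poly (q - 1) (\<lambda>S. P (card (A i \<inter> S)))" if "i \<in> I" for i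
    unfolding P_def
  proof (rule cube_poly_sum)
    fix j assume "j \<in> {..<q}"
    then have "cube_poly (q - 1) (\<lambda>S. int (card (A i \<inter> S) choose j))"
      using assms that by (intro cube_poly_binomial) (auto intro: finite_subset)
    then show "cube_poly (q - 1) (\<lambda>S. (- 1) ^ j * int (card (A i \<inter> S) choose j))"
      using cube_poly_mult[OF cube_poly_const[of 0 "(- 1) ^ j"]] by auto
  qed
  then have "cube_poly (card I * (q - 1)) F"
    unfolding F_def using assms(2) by (intro cube_poly_prod)
  then have "0 = (\<Sum>S\<in>Pow E. (- 1) ^ card S * F S)"
    using cube_poly_alternating_sum assms by (metis mult.commute)
  also have "\<dots> = F {} + (\<Sum>S\<in>Pow E - {{}}. (- 1) ^ card S * F S)"
    using assms(1) by (subst sum.remove[of _ "{}"]) auto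
  also have "F {} = 1"
  proof -
    have "P 0 = (\<Sum>j<q. if j = 0 then 1 else 0)"
      unfolding P_def by (intro sum.cong) auto
    then have "P 0 = 1"
      using q0 by simp
    then show ?thesis
      by (simp add: F_def)
  qed
  finally have "1 = - (\<Sum>S\<in>Pow E - {{}}. (- 1) ^ card S * F S)"
    by simp
  moreover have "int p dvd (\<Sum>S\<in>Pow E - {{}}. (- 1) ^ card S * F S)"
  proof (intro dvd_sum dvd_mult)
    fix S assume "S \<in> Pow E - {{}}"
    with neg obtain i where i: "i \<in> I" "\<not> q dvd card (A i \<inter> S)"
      by auto
    with p q have "int p dvd P (card (A i \<inter> S))"
      unfolding P_def by (auto intro: prime_dvd_alternating_binomial_sum)
    with i(1) assms(2) show "int p dvd F S"
      unfolding F_def by (meson dvd_prod_eqI dvd_trans dvd_prodI)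
  qed
  ultimately have "int p dvd 1"
    by (metis dvd_minus_iff)
  with p show False
    by (simp add: prime_nat_iff)
qed

section \<open>Factors of regular bipartite multigraphs\<close>

text \<open>Induction on the total size of the sets: while some set has two elements, one of them
  can be deleted without breaking Hall's condition. Once all sets are singletons, the condition on
  pairs makes them distinct.\<close>

theorem hall_representatives:
  assumes "finite I" and "\<And>i. i \<in> I \<Longrightarrow> finite (A i)"
    and "\<And>J. J \<subseteq> I \<Longrightarrow> card J \<le> card (\<Union>i\<in>J. A i)"
  shows "\<exists>\<phi>. inj_on \<phi> I \<and> (\<forall>i\<in>I. \<phi> i \<in> A i)"
  using assms(2,3)
proof (induction "\<Sum>i\<in>I. card (A i)" arbitrary: A rule: less_induct)
  case less
  have ne: "A i \<noteq> {}" if "i \<in> I" for i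
    using less.prems(2)[of "{i}"] that by auto
  have fin: "finite (\<Union>i\<in>J. A i)" if "J \<subseteq> I" for J
    using finite_subset[OF that assms(1)] less.prems(1) that by auto
  show ?case
  proof (cases "\<forall>i\<in>I. card (A i) \<le> 1")
    case True
    then have single: "\<exists>a. A i = {a}" if "i \<in> I" for i
    proof -
      have "card (A i) > 0"
        using ne[OF that] less.prems(1)[OF that] by (simp add: card_gt_0_iff)
      with True that have "card (A i) = 1"
        by force
      then show ?thesis
        by (rule card_1_singletonE) blast
    qed
    define \<phi> where "\<phi> i = the_elem (A i)" for i
    have \<phi>: "A i = {\<phi> i}" if "i \<in> I" for i
      unfolding \<phi>_def by (metis single[OF that] the_elem_eq)
    have "\<phi> i \<noteq> \<phi> j" if "i \<in> I" "j \<in> I" "i \<noteq> j" for i j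
      using less.prems(2)[of "{i, j}"] that \<phi>[OF that(1)] \<phi>[OF that(2)] by auto
    then have "inj_on \<phi> I"
      by (auto simp: inj_on_def)
    with \<phi> show ?thesis by (intro exI[of _ \<phi>]) blast
  next
    case False
    then obtain i where i: "i \<in> I" "card (A i) > 1"
      by force
    then obtain x y where xy: "x \<in> A i" "y \<in> A i" "x \<noteq> y"
      using card_le_Suc0_iff_eq[OF less.prems(1)[OF i(1)]] by (metis One_nat_def not_le)
    \<comment> \<open>Rado's argument: if deleting \<open>x\<close> and deleting \<open>y\<close> from \<open>A i\<close> both broke Hall's condition,
      on index sets \<open>J x\<close> and \<open>J y\<close>, then submodularity of the size of unions would contradict
      the condition for \<open>J x \<union> J y\<close> and \<open>(J x \<inter> J y) - {i}\<close>.\<close>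
    define B where "B z = A (i := A i - {z})" for z
    have "\<exists>z\<in>{x, y}. \<forall>J\<subseteq>I. card J \<le> card (\<Union>j\<in>J. B z j)"
    proof (rule ccontr)
      assume "\<not> ?thesis"
      then have "\<forall>z\<in>{x, y}. \<exists>J\<subseteq>I. card (\<Union>j\<in>J. B z j) < card J"
        by (meson not_le)
      then obtain J where J: "\<And>z. z \<in> {x, y} \<Longrightarrow> J z \<subseteq> I"
        "\<And>z. z \<in> {x, y} \<Longrightarrow> card (\<Union>j\<in>J z. B z j) < card (J z)"
        by metis
      have iJ: "i \<in> J z" if "z \<in> {x, y}" for z
      proof (rule ccontr)
        assume "i \<notin> J z"
        then have "(\<Union>j\<in>J z. B z j) = (\<Union>j\<in>J z. A j)"
          by (auto simp: B_def)
        then show False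
          using J[OF that] less.prems(2)[of "J z"] by simp
      qed
      let ?U = "\<lambda>z. \<Union>j\<in>J z. B z j"
      \<comment> \<open>The deletions of \<open>x\<close> and of \<open>y\<close> lose different
        elements of \<open>A i\<close>, and \<open>i\<close> lies in both index sets, so nothing is
        lost from the union.\<close>
      have sub: "(\<Union>j\<in>J x \<union> J y. A j) \<subseteq> ?U x \<union> ?U y"
      proof
        fix a assume "a \<in> (\<Union>j\<in>J x \<union> J y. A j)"
        then obtain j where "j \<in> J x \<union> J y" "a \<in> A j"
          by auto
        then show "a \<in> ?U x \<union> ?U y"
          using iJ[of x] iJ[of y] xy by (cases "j = i"; cases "a = x") (auto simp: B_def)
      qed
      have sub': "(\<Union>j\<in>J x \<inter> J y - {i}. A j) \<subseteq> ?U x \<inter> ?U y"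
        by (auto simp: B_def)
      have finU: "finite (?U z)" if "z \<in> {x, y}" for z
        by (rule finite_subset[OF _ fin[OF J(1)[OF that]]]) (auto simp: B_def split: if_splits)
      have finJ: "finite (J z)" if "z \<in> {x, y}" for z
        using J(1)[OF that] assms(1) finite_subset by blast
      have "card (J x \<union> J y) \<le> card (?U x \<union> ?U y)"
        using less.prems(2)[of "J x \<union> J y"] J(1) card_mono[OF _ sub] finU by fastforce
      moreover have "card (J x \<inter> J y - {i}) \<le> card (?U x \<inter> ?U y)"
        using less.prems(2)[of "J x \<inter> J y - {i}"] J(1)[of x] card_mono[OF _ sub'] finU by fastforce
      moreover have "card (?U x) + card (?U y) = card (?U x \<union> ?U y) + card (?U x \<inter> ?U y)"
        using finU by (intro card_Un_Int) auto
      moreover have "card (J x) + card (J y) = card (J x \<union> J y) + card (J x \<inter> J y)"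
        using finJ by (intro card_Un_Int) auto
      moreover have "card (J x \<inter> J y) = Suc (card (J x \<inter> J y - {i}))"
        using finJ iJ by (intro card.remove) auto
      \<comment> \<open>The strict bounds for \<open>J x\<close> and \<open>J y\<close> give a
        deficit of at least 2, while dropping \<open>i\<close> from the intersection accounts for
        only 1.\<close>
      ultimately show False
        using J(2)[of x] J(2)[of y] by simp
    qed
    then obtain z where z: "z \<in> {x, y}" "\<forall>J\<subseteq>I. card J \<le> card (\<Union>j\<in>J. B z j)"
      by blast
    have rec: "\<exists>\<phi>. inj_on \<phi> I \<and> (\<forall>j\<in>I. \<phi> j \<in> B z j)"
    proof (rule less.hyps)
      show "(\<Sum>j\<in>I. card (B z j)) < (\<Sum>j\<in>I. card (A j))"
      proof (rule sum_strict_mono_ex1)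
        show "\<forall>j\<in>I. card (B z j) \<le> card (A j)"
          using less.prems(1) by (auto simp: B_def intro: card_mono)
        show "\<exists>j\<in>I. card (B z j) < card (A j)"
          using i z(1) xy less.prems(1)[of i]
          by (intro bexI[of _ i]) (auto simp: B_def intro!: psubset_card_mono)
      qed (fact assms(1))
    qed (use less.prems(1) z(2) in \<open>auto simp: B_def split: if_splits\<close>)
    have "B z j \<subseteq> A j" for j
      by (auto simp: B_def)
    with rec show ?thesis by blast
  qed
qed

lemma card_eq_fibre_size_times:
  assumes "finite S" and "\<And>y. y \<in> Y \<Longrightarrow> card {e \<in> S. f e = y} = q" and "finite Y" and "f ` S \<subseteq> Y"
  shows "card S = q * card Y"
proof -
  have "card S = (\<Sum>y\<in>Y. card {e \<in> S. f e = y})"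
    using sum.group[OF assms(1,3,4), of "\<lambda>_. 1 :: nat"] by simp
  with assms(2) show ?thesis by simp
qed

text \<open>A bipartite multigraph is represented by a set \<open>S\<close> of edges with maps
  \<open>l\<close> and \<open>r\<close> to their ends on the two sides; it is
  \<open>q\<close>-regular when both maps have this property.\<close>

definition uniform_fibres :: "('e \<Rightarrow> 'a) \<Rightarrow> nat \<Rightarrow> 'a set \<Rightarrow> 'e set \<Rightarrow> bool" where
  "uniform_fibres f q Y S \<longleftrightarrow> f ` S \<subseteq> Y \<and> (\<forall>y\<in>Y. card {e \<in> S. f e = y} = q)"

lemma card_uniform_fibres:
  "finite S \<Longrightarrow> finite Y \<Longrightarrow> uniform_fibres f q Y S \<Longrightarrow> card S = q * card Y"
  unfolding uniform_fibres_def by (intro card_eq_fibre_size_times) auto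

text \<open>Hall's condition holds because the \<open>q * card J\<close> edges leaving
  \<open>J\<close> are among the edges at its neighbours, \<open>q\<close> at each. The two sides
  have equal size, so the injection is onto.\<close>

lemma perfect_matching_of_regular_bipartite:
  assumes fin: "finite S" "finite X" "finite Y"
    and l: "uniform_fibres l q X S" and r: "uniform_fibres r q Y S" and q: "q > 0"
  shows "\<exists>M\<subseteq>S. uniform_fibres l 1 X M \<and> uniform_fibres r 1 Y M"
proof -
  have XY: "card X = card Y"
    using card_uniform_fibres[OF fin(1,2) l] card_uniform_fibres[OF fin(1,3) r] q by simp
  define N where "N x = r ` {e \<in> S. l e = x}" for x
  have "card J \<le> card (\<Union>x\<in>J. N x)" if J: "J \<subseteq> X" for J
  proof -
    let ?T = "{e \<in> S. l e \<in> J}"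
    let ?U = "{e \<in> S. r e \<in> r ` ?T}"
    have "{e \<in> ?T. l e = x} = {e \<in> S. l e = x}" if "x \<in> J" for x
      using that by auto
    then have "card ?T = q * card J"
      using J l fin by (intro card_eq_fibre_size_times[where f = l])
        (auto simp: uniform_fibres_def finite_subset)
    moreover have "{e \<in> ?U. r e = y} = {e \<in> S. r e = y}" if "y \<in> r ` ?T" for y
      using that by auto
    then have "card ?U = q * card (r ` ?T)"
      using r fin by (intro card_eq_fibre_size_times[where f = r]) (auto simp: uniform_fibres_def)
    moreover have "card ?T \<le> card ?U"
      using fin by (intro card_mono) auto
    ultimately have "card J \<le> card (r ` ?T)"
      using q by simp
    also have "r ` ?T = (\<Union>x\<in>J. N x)"
      by (auto simp: N_def)
    finally show ?thesis .
  qed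
  then obtain \<phi> where \<phi>: "inj_on \<phi> X" "\<And>x. x \<in> X \<Longrightarrow> \<phi> x \<in> N x"
    using hall_representatives[OF fin(2), of N] fin(1) unfolding N_def by auto
  then have "\<forall>x\<in>X. \<exists>e\<in>S. l e = x \<and> r e = \<phi> x"
    unfolding N_def by fastforce
  \<comment> \<open>Hall's theorem supplies neighbours rather than edges, so one of possibly several
    parallel edges is chosen for each \<open>x\<close>.\<close>
  then obtain m where m: "\<And>x. x \<in> X \<Longrightarrow> m x \<in> S \<and> l (m x) = x \<and> r (m x) = \<phi> x"
    by metis
  have "\<phi> ` X \<subseteq> Y"
    using \<phi>(2) r by (fastforce simp: N_def uniform_fibres_def)
  then have onto: "\<phi> ` X = Y"
    using \<phi>(1) XY fin by (simp add: card_image card_subset_eq)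
  have "{e \<in> m ` X. l e = x} = {m x}" if "x \<in> X" for x
    using that m by force
  moreover have "{e \<in> m ` X. r e = \<phi> x} = {m x}" if "x \<in> X" for x
    using that m \<phi>(1) by (force simp: inj_on_def)
  ultimately have "uniform_fibres l 1 X (m ` X) \<and> uniform_fibres r 1 Y (m ` X)"
    using m onto unfolding uniform_fibres_def by auto
  moreover have "m ` X \<subseteq> S"
    using m by auto
  ultimately show ?thesis by blast
qed

text \<open>Downward induction from \<open>q\<close>: removing a perfect matching lowers every
  degree by one.\<close>

lemma regular_bipartite_factor:
  assumes fin: "finite S" "finite X" "finite Y"
    and "uniform_fibres l q X S" and "uniform_fibres r q Y S" and "k \<le> q"
  shows "\<exists>M\<subseteq>S. uniform_fibres l k X M \<and> uniform_fibres r k Y M"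
  using \<open>k \<le> q\<close>
proof (induction k rule: inc_induct)
  case base
  then show ?case using assms by blast
next
  case (step k)
  then obtain M where M: "M \<subseteq> S" "uniform_fibres l (Suc k) X M" "uniform_fibres r (Suc k) Y M"
    by blast
  have finM: "finite M"
    using M(1) fin(1) finite_subset by blast
  then obtain P where P: "P \<subseteq> M" "uniform_fibres l 1 X P" "uniform_fibres r 1 Y P"
    using perfect_matching_of_regular_bipartite[OF finM fin(2,3) M(2,3)] by auto
  have "uniform_fibres f k Z (M - P)"
    if "uniform_fibres f (Suc k) Z M" "uniform_fibres f 1 Z P" for f :: "'a \<Rightarrow> 'z" and Z
    unfolding uniform_fibres_def
  proof (intro conjI ballI)
    fix z assume z: "z \<in> Z"
    have "{e \<in> M - P. f e = z} = {e \<in> M. f e = z} - {e \<in> P. f e = z}"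
      by auto
    moreover have "card ({e \<in> M. f e = z} - {e \<in> P. f e = z}) =
        card {e \<in> M. f e = z} - card {e \<in> P. f e = z}"
      using P(1) finM by (intro card_Diff_subset) (auto intro: finite_subset)
    ultimately show "card {e \<in> M - P. f e = z} = k"
      using that z by (simp add: uniform_fibres_def)
  qed (use that in \<open>auto simp: uniform_fibres_def\<close>)
  with M P show ?case
    by (meson Diff_subset subset_trans)
qed

section \<open>Splitting vertices into vertices of degree \<open>q\<close> and merging them
  again\<close>

lemma card_div_fibre:
  assumes "q > 0" and "q dvd n" and "i < n"
  shows "card {j \<in> {0..<n}. j div q = i div q} = q"
proof -
  obtain m where m: "n = q * m"
    using assms(2) by blast
  have "i div q < m"
    using assms m by (simp add: div_less_iff_less_mult mult.commute)
  \<comment> \<open>Since \<open>q dvd n\<close>, the block of \<open>i\<close> is not cut off at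
    \<open>n\<close>.\<close>
  then have le: "q * Suc (i div q) \<le> n"
    unfolding m by (intro mult_le_mono) auto
  have "{j \<in> {0..<n}. j div q = i div q} = {q * (i div q)..<q * Suc (i div q)}"
  proof (intro equalityI subsetI)
    fix j assume "j \<in> {j \<in> {0..<n}. j div q = i div q}"
    then have "j div q = i div q" by auto
    with assms(1) show "j \<in> {q * (i div q)..<q * Suc (i div q)}"
      using dividend_less_times_div[of q j] times_div_less_eq_dividend[of q j] by auto
  next
    fix j assume j: "j \<in> {q * (i div q)..<q * Suc (i div q)}"
    then have "j div q = i div q"
      using assms(1) by (intro div_nat_eqI) (auto simp: mult.commute)
    with j le show "j \<in> {j \<in> {0..<n}. j div q = i div q}"
      by auto
  qed
  then show ?thesis by simp
qed

lemma split_into_blocks: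
  assumes "finite A" and "q > 0" and "q dvd card A"
  shows "\<exists>\<rho> :: 'a \<Rightarrow> nat. \<forall>x\<in>A. card {y \<in> A. \<rho> y = \<rho> x} = q"
proof -
  obtain h where h: "bij_betw h A {0..<card A}"
    using ex_bij_betw_finite_nat[OF assms(1)] by blast
  have "card {y \<in> A. h y div q = h x div q} = q" if "x \<in> A" for x
  proof -
    have "bij_betw h {y \<in> A. h y div q = h x div q} {j \<in> {0..<card A}. j div q = h x div q}"
      using h by (auto simp: bij_betw_def inj_on_def)
    then show ?thesis
      using bij_betwE[OF h] that card_div_fibre[OF assms(2,3), of "h x"] bij_betw_same_card by fastforce
  qed
  then show ?thesis
    by (intro exI[of _ "\<lambda>x. h x div q"]) simp
qed

text \<open>Splits each vertex \<open>v\<close> into vertices \<open>(v, i)\<close> of degree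
  \<open>q\<close>. Keeping \<open>v\<close> as first component lets \<open>dvd_card_fibre\<close>
  merge them again.\<close>

lemma refine_to_uniform_fibres:
  assumes "finite S" and "q > 0" and "\<And>v. q dvd card {e \<in> S. f e = v}"
  shows "\<exists>\<rho> :: 'e \<Rightarrow> 'v \<times> nat. (\<forall>e. fst (\<rho> e) = f e) \<and> uniform_fibres \<rho> q (\<rho> ` S) S"
proof -
  have "\<exists>\<rho> :: 'v \<Rightarrow> 'e \<Rightarrow> nat.
      \<forall>v. \<forall>x\<in>{e \<in> S. f e = v}. card {y \<in> {e \<in> S. f e = v}. \<rho> v y = \<rho> v x} = q"
    using assms by (intro choice allI split_into_blocks) auto
  then obtain \<rho> :: "'v \<Rightarrow> 'e \<Rightarrow> nat" where
    \<rho>: "\<And>v x. x \<in> S \<Longrightarrow> f x = v \<Longrightarrow> card {y \<in> {e \<in> S. f e = v}. \<rho> v y = \<rho> v x} = q"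
    by blast
  define \<sigma> where "\<sigma> e = (f e, \<rho> (f e) e)" for e
  have "card {y \<in> S. \<sigma> y = \<sigma> x} = q" if "x \<in> S" for x
  proof -
    have "{y \<in> S. \<sigma> y = \<sigma> x} = {y \<in> {e \<in> S. f e = f x}. \<rho> (f x) y = \<rho> (f x) x}"
      by (auto simp: \<sigma>_def)
    with \<rho>[OF that refl] show ?thesis by simp
  qed
  then have "uniform_fibres \<sigma> q (\<sigma> ` S) S"
    by (auto simp: uniform_fibres_def)
  then show ?thesis
    by (intro exI[of _ \<sigma>]) (auto simp: \<sigma>_def)
qed

lemma dvd_card_fibre:
  assumes "finite M" and "uniform_fibres \<rho> k X M" and "\<And>e. fst (\<rho> e) = f e"
  shows "k dvd card {e \<in> M. f e = v}"
proof -
  let ?C = "(\<lambda>x. {e \<in> M. \<rho> e = x}) ` {x \<in> X. fst x = v}"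
  have "{e \<in> M. f e = v} = \<Union> ?C"
    using assms(2) by (auto simp: uniform_fibres_def assms(3)[symmetric])
  moreover have "k dvd card (\<Union> ?C)"
  proof (rule dvd_partition)
    show "finite (\<Union> ?C)"
      by (rule finite_subset[OF _ assms(1)]) auto
  qed (use assms(2) in \<open>auto simp: uniform_fibres_def\<close>)
  ultimately show ?thesis by simp
qed

text \<open>Splitting the vertices on both sides makes the graph \<open>q\<close>-regular; a
  \<open>k\<close>-factor of it has degrees divisible by \<open>k\<close> after merging.\<close>

lemma bipartite_dvd_reduce:
  fixes l r :: "'e \<Rightarrow> 'v"
  assumes "finite S" and "S \<noteq> {}" and "0 < k" and "k \<le> q"
    and "\<And>v. q dvd card {e \<in> S. l e = v}" and "\<And>v. q dvd card {e \<in> S. r e = v}"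
  shows "\<exists>M\<subseteq>S. M \<noteq> {} \<and> (\<forall>v. k dvd card {e \<in> M. l e = v} \<and> k dvd card {e \<in> M. r e = v})"
proof -
  obtain \<rho> :: "'e \<Rightarrow> 'v \<times> nat" where \<rho>: "\<And>e. fst (\<rho> e) = l e" "uniform_fibres \<rho> q (\<rho> ` S) S"
    using refine_to_uniform_fibres[of S q l] assms by auto
  obtain \<sigma> :: "'e \<Rightarrow> 'v \<times> nat" where \<sigma>: "\<And>e. fst (\<sigma> e) = r e" "uniform_fibres \<sigma> q (\<sigma> ` S) S"
    using refine_to_uniform_fibres[of S q r] assms by auto
  obtain M where M: "M \<subseteq> S" "uniform_fibres \<rho> k (\<rho> ` S) M" "uniform_fibres \<sigma> k (\<sigma> ` S) M"
    using regular_bipartite_factor[OF _ _ _ \<rho>(2) \<sigma>(2) assms(4)] assms(1) by auto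
  have finM: "finite M"
    using M(1) assms(1) finite_subset by blast
  \<comment> \<open>Both factors are positive, since \<open>S\<close> is nonempty; this rules out an
    empty \<open>M\<close>.\<close>
  have "card M = k * card (\<rho> ` S)"
    using card_uniform_fibres[OF finM _ M(2)] assms(1) by simp
  then have "M \<noteq> {}"
    using assms by auto
  with M(1) dvd_card_fibre[OF finM M(2) \<rho>(1)] dvd_card_fibre[OF finM M(3) \<sigma>(1)]
  show ?thesis by blast
qed

section \<open>Bipartite subgraphs\<close>

text \<open>One vertex is left out of the polynomial argument, which is why
  \<open>card V - 1\<close> suffices in the bound. Degrees are first made divisible by
  \<open>q\<close>, and then reduced to \<open>k\<close>.\<close>

lemma bipartite_exists_dvd:
  fixes l r :: "'e \<Rightarrow> 'v"
  assumes fin: "finite E" "finite V" and lr: "l ` E \<subseteq> V" "r ` E \<subseteq> V" "l ` E \<inter> r ` E = {}"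
    and q: "primepow q" and k: "0 < k" "k \<le> q" and card: "(q - 1) * (card V - 1) < card E"
  shows "\<exists>M\<subseteq>E. M \<noteq> {} \<and> (\<forall>v. k dvd card {e \<in> M. l e = v} \<and> k dvd card {e \<in> M. r e = v})"
proof -
  obtain e\<^sub>0 where e0: "e\<^sub>0 \<in> E"
    using card by fastforce
  \<comment> \<open>The omitted vertex is a left end, so every right-hand degree stays under direct
    control.\<close>
  define v\<^sub>0 where "v\<^sub>0 = l e\<^sub>0"
  have v0: "v\<^sub>0 \<in> V" "v\<^sub>0 \<notin> r ` E"
    using e0 lr by (auto simp: v\<^sub>0_def)
  have disj: "l e \<noteq> r e'" if "e \<in> E" "e' \<in> E" for e e'
    using lr(3) that by blast
  \<comment> \<open>The degree sums over the two sides agree, so divisibility at \<open>v\<^sub>0\<close> comes for free.\<close>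
  define A where "A v = {e \<in> E. l e = v \<or> r e = v}" for v
  have "card (V - {v\<^sub>0}) = card V - 1"
    using v0 by simp
  with card have "(q - 1) * card (V - {v\<^sub>0}) < card E"
    by simp
  then obtain S where S: "S \<subseteq> E" "S \<noteq> {}" "\<And>v. v \<in> V - {v\<^sub>0} \<Longrightarrow> q dvd card (A v \<inter> S)"
    using exists_subset_all_dvd[of E "V - {v\<^sub>0}" q A] fin q by (auto simp: A_def)
  have finS: "finite S"
    using S(1) fin(1) finite_subset by blast
  have AS: "A (l e) \<inter> S = {e' \<in> S. l e' = l e}" "A (r e) \<inter> S = {e' \<in> S. r e' = r e}"
    if "e \<in> S" for e
    using that S(1) disj by (fastforce simp: A_def)+
  have fibre: "q dvd card {e \<in> S. f e = v}"
    if f: "f = l \<or> f = r" and v: "v \<noteq> v\<^sub>0" for f v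
  proof (cases "v \<in> f ` S")
    case True
    then obtain e where e: "e \<in> S" "v = f e"
      by auto
    then have "f e \<in> f ` E"
      using S(1) by blast
    with e f lr v have "v \<in> V - {v\<^sub>0}"
      by blast
    then have "q dvd card (A v \<inter> S)"
      by (rule S(3))
    moreover have "A v \<inter> S = {e \<in> S. f e = v}"
      using f AS[OF e(1)] unfolding e(2) by blast
    ultimately show ?thesis
      by simp
  next
    case False
    then have "{e \<in> S. f e = v} = {}"
      by auto
    then show ?thesis
      by (simp only: card.empty dvd_0_right)
  qed
  have total: "card S = (\<Sum>v\<in>V. card {e \<in> S. f e = v})" if "f ` E \<subseteq> V" for f
  proof -
    have "f ` S \<subseteq> V"
      using that S(1) by blast
    then show ?thesis
      using sum.group[OF finS fin(2), of f "\<lambda>_. 1 :: nat"] by simp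
  qed
  have r: "q dvd card {e \<in> S. r e = v}" for v
  proof (cases "v = v\<^sub>0")
    case True
    then have "{e \<in> S. r e = v} = {}"
      using v0 S(1) by auto
    then show ?thesis
      by (simp only: card.empty dvd_0_right)
  qed (use fibre in blast)
  have "q dvd card S"
    unfolding total[OF lr(2)] by (intro dvd_sum r)
  also have "card S = card {e \<in> S. l e = v\<^sub>0} + (\<Sum>v\<in>V - {v\<^sub>0}. card {e \<in> S. l e = v})"
    unfolding total[OF lr(1)] using fin(2) v0(1) by (rule sum.remove)
  finally have "q dvd card {e \<in> S. l e = v\<^sub>0}"
    using fibre by (subst (asm) dvd_add_left_iff) (auto intro!: dvd_sum)
  then have l: "q dvd card {e \<in> S. l e = v}" for v
    using fibre by (cases "v = v\<^sub>0") auto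
  show ?thesis
    using bipartite_dvd_reduce[OF finS S(2) k l r] S(1) by (meson subset_trans)
qed

text \<open>Disjoint sides exclude loops and make the degree of a vertex the size of a single fibre
  of \<open>l\<close> or of \<open>r\<close>.\<close>

lemma has_bipartite_modulo_regular_subgraphI:
  assumes G: "graph G" and M: "M \<subseteq> edges G" "M \<noteq> {}"
    and ends: "\<And>e. e \<in> M \<Longrightarrow> ends G e = {l e, r e}" and disj: "l ` M \<inter> r ` M = {}"
    and dvd: "\<And>v. k dvd card {e \<in> M. l e = v}" "\<And>v. k dvd card {e \<in> M. r e = v}"
  shows "has_bipartite_modulo_regular_subgraph k G"
proof -
  \<comment> \<open>Only ends of edges in \<open>M\<close> become vertices, so that all degrees are
    positive.\<close>
  define H where "H = \<lparr>vertices = l ` M \<union> r ` M, edges = M, ends = ends G\<rparr>"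
  have finM: "finite M"
    using G M finite_subset by (auto simp: graph_def)
  have "vertices H \<subseteq> vertices G"
    using G M(1) ends by (fastforce simp: H_def graph_def)
  moreover have "graph H"
  proof -
    have "ends G e \<subseteq> l ` M \<union> r ` M \<and> card (ends G e) \<in> {1, 2}" if "e \<in> M" for e
    proof
      show "ends G e \<subseteq> l ` M \<union> r ` M"
        unfolding ends[OF that] using that by blast
      show "card (ends G e) \<in> {1, 2}"
        using G M(1) that by (auto simp: graph_def)
    qed
    with M(2) finM show ?thesis
      by (auto simp: H_def graph_def)
  qed
  ultimately have "subgraph H G"
    using M(1) by (simp add: subgraph_def H_def)
  moreover have "bipartite H"
    unfolding bipartite_def
    by (rule exI[of _ "l ` M"], rule exI[of _ "r ` M"]) (use ends disj in \<open>auto simp: H_def\<close>)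
  moreover have "modulo_regular k H"
    unfolding modulo_regular_def
  proof
    fix v assume v: "v \<in> vertices H"
    have lr: "l e \<noteq> r e'" if "e \<in> M" "e' \<in> M" for e e'
      using disj that by blast
    have "ends G e \<noteq> {v}" if "e \<in> M" for e
      using ends[OF that] lr[OF that that] by auto
    then have "{e \<in> M. ends G e = {v}} = {}"
      by blast
    then have "card {e \<in> M. ends G e = {v}} = 0"
      by (simp only: card.empty)
    then have deg: "degree H v = card {e \<in> M. v \<in> ends G e}"
      by (simp add: degree_def H_def)
    obtain f where f: "f = l \<or> f = r" "v \<in> f ` M"
      using v by (auto simp: H_def)
    then obtain e\<^sub>0 where e0: "e\<^sub>0 \<in> M" "v = f e\<^sub>0"
      by blast
    have "v \<in> ends G e \<longleftrightarrow> f e = v" if "e \<in> M" for e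
      unfolding ends[OF that] e0(2) using f(1) lr[OF that e0(1)] lr[OF e0(1) that]
      by (metis insert_iff singleton_iff)
    then have eq: "{e \<in> M. v \<in> ends G e} = {e \<in> M. f e = v}"
      by blast
    have "{e \<in> M. f e = v} \<noteq> {}"
      using f(2) by auto
    then have "card {e \<in> M. f e = v} > 0"
      using finM by (simp add: card_gt_0_iff)
    with dvd f(1) show "degree H v > 0 \<and> k dvd degree H v"
      unfolding deg eq by auto
  qed
  ultimately show ?thesis
    unfolding has_bipartite_modulo_regular_subgraph_def by blast
qed

section \<open>Balanced cuts of coloured graphs\<close>

lemma card_separating_sets:
  assumes "finite U" and "a \<in> U" and "b \<in> U" and "a \<noteq> b" and "t > 0"
  shows "card {T. T \<subseteq> U \<and> card T = t \<and> a \<in> T \<and> b \<notin> T} = (card U - 2) choose (t - 1)"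
proof -
  let ?K = "{T. T \<subseteq> U - {a, b} \<and> card T = t - 1}"
  have fin: "finite T" if "T \<subseteq> U" for T
    using that assms(1) finite_subset by blast
  have "{T. T \<subseteq> U \<and> card T = t \<and> a \<in> T \<and> b \<notin> T} = insert a ` ?K"
  proof (intro equalityI subsetI)
    fix T assume T: "T \<in> {T. T \<subseteq> U \<and> card T = t \<and> a \<in> T \<and> b \<notin> T}"
    then have "T = insert a (T - {a})" and "T - {a} \<in> ?K"
      by auto
    then show "T \<in> insert a ` ?K"
      by blast
  next
    fix T assume "T \<in> insert a ` ?K"
    then obtain T' where T': "T' \<subseteq> U - {a, b}" "card T' = t - 1" "T = insert a T'"
      by blast
    moreover have "finite T'"
      using T'(1) fin by blast
    ultimately show "T \<in> {T. T \<subseteq> U \<and> card T = t \<and> a \<in> T \<and> b \<notin> T}"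
      using assms by (auto simp: card_insert_if)
  qed
  moreover have "inj_on (insert a) ?K"
    by (intro inj_onI) (auto simp: insert_ident)
  ultimately have "card {T. T \<subseteq> U \<and> card T = t \<and> a \<in> T \<and> b \<notin> T} = card ?K"
    by (simp add: card_image)
  also have "\<dots> = card (U - {a, b}) choose (t - 1)"
    using assms(1) by (simp add: n_subsets)
  also have "card (U - {a, b}) = card U - 2"
    using assms by (subst card_Diff_subset) auto
  finally show ?thesis .
qed

text \<open>Says, without division, that a fraction \<open>t / (2 * t - 1)\<close> of the
  \<open>t\<close>-subsets of \<open>2 * t\<close> colours separates two given colours.\<close>

lemma central_binomial_absorb:
  assumes "t > 0"
  shows "(2 * t - 1) * (2 * ((2 * t - 2) choose (t - 1))) = t * ((2 * t) choose t)"
proof -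
  obtain s where s: "t = Suc s"
    using assms gr0_implies_Suc by blast
  have "Suc s * (Suc (Suc (2 * s)) choose Suc s) = 2 * Suc s * (Suc (2 * s) choose s)"
    using Suc_times_binomial[of s "Suc (2 * s)"] by simp
  also have "Suc (2 * s) choose s = Suc (2 * s) choose Suc s"
    using binomial_symmetric[of s "Suc (2 * s)"] by simp
  also have "2 * Suc s * (Suc (2 * s) choose Suc s) = 2 * (Suc (2 * s) * (2 * s choose s))"
    using Suc_times_binomial[of s "2 * s"] by simp
  finally show ?thesis
    by (simp add: s algebra_simps)
qed

text \<open>Averaging over all \<open>t\<close>-subsets \<open>T\<close> of the colours;
  \<open>a e\<close> and \<open>b e\<close> are the colours of the two ends of
  \<open>e\<close>.\<close>

lemma exists_balanced_cut:
  fixes a b :: "'e \<Rightarrow> nat"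
  assumes "finite E" and "t > 0" and ab: "\<And>e. e \<in> E \<Longrightarrow> a e < 2 * t \<and> b e < 2 * t \<and> a e \<noteq> b e"
  shows "\<exists>T. t * card E \<le> (2 * t - 1) * card {e \<in> E. a e \<in> T \<longleftrightarrow> b e \<notin> T}"
proof (rule ccontr)
  assume neg: "\<not> ?thesis"
  let ?F = "{T. T \<subseteq> {..<2 * t} \<and> card T = t}"
  let ?c = "(2 * t - 2) choose (t - 1)"
  have cardF: "card ?F = (2 * t) choose t"
    using n_subsets[of "{..<2 * t}" t] by simp
  moreover have "(2 * t) choose t > 0"
    by simp
  ultimately have F: "finite ?F" "?F \<noteq> {}"
    using card_gt_0_iff by metis+
  have "card {T \<in> ?F. a e \<in> T \<longleftrightarrow> b e \<notin> T} = 2 * ?c" if "e \<in> E" for e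
  proof -
    let ?D = "\<lambda>x y. {T. T \<subseteq> {..<2 * t} \<and> card T = t \<and> x \<in> T \<and> y \<notin> T}"
    have "{T \<in> ?F. a e \<in> T \<longleftrightarrow> b e \<notin> T} = ?D (a e) (b e) \<union> ?D (b e) (a e)"
      by auto
    moreover have "card (?D (a e) (b e) \<union> ?D (b e) (a e)) = card (?D (a e) (b e)) + card (?D (b e) (a e))"
      by (intro card_Un_disjoint) (auto intro: finite_subset[OF _ F(1)])
    moreover have "card (?D (a e) (b e)) = ?c" "card (?D (b e) (a e)) = ?c"
      using ab[OF that] assms(2) card_separating_sets[of "{..<2 * t}"] by auto
    ultimately show ?thesis by simp
  qed
  \<comment> \<open>Double counting of the pairs of a set \<open>T\<close> and an edge that it
    separates.\<close>
  then have "(\<Sum>T\<in>?F. card {e \<in> E. a e \<in> T \<longleftrightarrow> b e \<notin> T}) = 2 * ?c * card E"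
    using F(1) assms(1) by (intro sum_multicount) auto
  then have "(\<Sum>T\<in>?F. (2 * t - 1) * card {e \<in> E. a e \<in> T \<longleftrightarrow> b e \<notin> T}) = (2 * t - 1) * (2 * ?c) * card E"
    by (simp add: sum_distrib_left[symmetric])
  also have "\<dots> = (\<Sum>T\<in>?F. t * card E)"
    using cardF central_binomial_absorb[OF assms(2)] by simp
  finally have "\<not> (\<Sum>T\<in>?F. (2 * t - 1) * card {e \<in> E. a e \<in> T \<longleftrightarrow> b e \<notin> T}) < (\<Sum>T\<in>?F. t * card E)"
    by simp
  moreover have "(\<Sum>T\<in>?F. (2 * t - 1) * card {e \<in> E. a e \<in> T \<longleftrightarrow> b e \<notin> T}) < (\<Sum>T\<in>?F. t * card E)"
    using F neg by (intro sum_strict_mono) (auto simp: not_le)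
  ultimately show False by blast
qed

section \<open>Colourings and edge density\<close>

lemma loopless_card_ends: "graph G \<Longrightarrow> loopless G \<Longrightarrow> e \<in> edges G \<Longrightarrow> card (ends G e) = 2"
  by (auto simp: graph_def loopless_def)

text \<open>The factor \<open>2 - 1 / t\<close> is the inverse of the fraction of edges kept by a
  balanced cut, so the cut has more than \<open>(q - 1) * (order G - 1)\<close> edges.\<close>

lemma bipartite_modulo_regular_of_colouring:
  assumes G: "graph G" "loopless G" and col: "proper_colouring G (2 * t) f" and t: "t > 0"
    and q: "primepow q" and k: "0 < k" "k \<le> q"
    and card: "real (card (edges G)) > (2 - 1 / real t) * (real q - 1) * (real (order G) - 1)"
  shows "has_bipartite_modulo_regular_subgraph k G"
proof -
  let ?E = "edges G" and ?V = "vertices G"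
  have fin: "finite ?E" "finite ?V" "?V \<noteq> {}"
    using G by (auto simp: graph_def)
  have "\<forall>e\<in>?E. \<exists>x y. ends G e = {x, y}"
    using loopless_card_ends[OF G] by (meson card_2_iff)
  then obtain x y where xy: "\<And>e. e \<in> ?E \<Longrightarrow> ends G e = {x e, y e}"
    by metis
  have inV: "x e \<in> ?V" "y e \<in> ?V" if "e \<in> ?E" for e
    using G(1) xy[OF that] that by (auto simp: graph_def)
  have colours: "f (x e) < 2 * t \<and> f (y e) < 2 * t \<and> f (x e) \<noteq> f (y e)" if "e \<in> ?E" for e
    using col xy[OF that] inV[OF that] that by (auto simp: proper_colouring_def)
  obtain T where T: "t * card ?E \<le> (2 * t - 1) * card {e \<in> ?E. f (x e) \<in> T \<longleftrightarrow> f (y e) \<notin> T}"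
    using exists_balanced_cut[OF fin(1) t, of "\<lambda>e. f (x e)" "\<lambda>e. f (y e)"] colours by auto
  define C where "C = {e \<in> ?E. f (x e) \<in> T \<longleftrightarrow> f (y e) \<notin> T}"
  define l where "l e = (if f (x e) \<in> T then x e else y e)" for e
  define r where "r e = (if f (x e) \<in> T then y e else x e)" for e
  have lT: "f (l e) \<in> T" "f (r e) \<notin> T" if "e \<in> C" for e
    using that by (auto simp: C_def l_def r_def)
  then have disj: "l ` C \<inter> r ` C = {}"
    by force
  have CE: "C \<subseteq> ?E"
    by (auto simp: C_def)
  have lrV: "l ` C \<subseteq> ?V" "r ` C \<subseteq> ?V"
    using inV by (auto simp: C_def l_def r_def)
  have "(2 * real t - 1) * ((real q - 1) * (real (order G) - 1)) =
      real t * ((2 - 1 / real t) * (real q - 1) * (real (order G) - 1))"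
    using t by (simp add: field_simps)
  also have "\<dots> < real t * real (card ?E)"
    using card t by (intro mult_strict_left_mono) auto
  also have "\<dots> \<le> real ((2 * t - 1) * card C)"
    using T unfolding C_def by (simp only: of_nat_mult[symmetric] of_nat_le_iff)
  also have "\<dots> = (2 * real t - 1) * real (card C)"
    using t by (simp add: of_nat_diff)
  finally have "(real q - 1) * (real (order G) - 1) < real (card C)"
    using t by (subst (asm) mult_less_cancel_left_pos) auto
  moreover have "order G \<ge> 1"
    using fin by (simp add: order_def Suc_le_eq card_gt_0_iff)
  moreover have "q \<ge> 1"
    using k by simp
  ultimately have "real ((q - 1) * (card ?V - 1)) < real (card C)"
    by (simp add: order_def of_nat_diff)
  then have "(q - 1) * (card ?V - 1) < card C"
    by (simp only: of_nat_less_iff)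
  then obtain M where M: "M \<subseteq> C" "M \<noteq> {}"
    "\<And>v. k dvd card {e \<in> M. l e = v}" "\<And>v. k dvd card {e \<in> M. r e = v}"
    using bipartite_exists_dvd[OF finite_subset[OF CE fin(1)] fin(2) lrV disj q k] by blast
  show ?thesis
  proof (rule has_bipartite_modulo_regular_subgraphI[OF G(1) _ M(2) _ _ M(3,4)])
    show "M \<subseteq> ?E"
      using M(1) CE by blast
    show "l ` M \<inter> r ` M = {}"
      using disj M(1) by blast
    show "ends G e = {l e, r e}" if "e \<in> M" for e
      using xy[of e] that M(1) CE by (auto simp: l_def r_def)
  qed
qed

text \<open>The \<open>LEAST\<close> in \<open>chromatic_number\<close> is attained because
  numbering the vertices injectively properly colours a loopless graph.\<close>

lemma proper_colouring_of_chromatic_number_le: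
  assumes G: "graph G" "loopless G" and "chromatic_number G \<le> c"
  shows "\<exists>f. proper_colouring G c f"
proof -
  obtain h where h: "bij_betw h (vertices G) {0..<card (vertices G)}"
    using G(1) ex_bij_betw_finite_nat unfolding graph_def by blast
  have "proper_colouring G (card (vertices G)) h"
    unfolding proper_colouring_def
  proof (intro conjI ballI allI impI)
    show "h ` vertices G \<subseteq> {..<card (vertices G)}"
      using h by (auto simp: bij_betw_def)
    fix e u v assume e: "e \<in> edges G" "ends G e = {u, v}"
    then have "u \<noteq> v"
      using G(2) by (auto simp: loopless_def)
    moreover have "u \<in> vertices G" "v \<in> vertices G"
      using G(1) e by (auto simp: graph_def)
    ultimately show "h u \<noteq> h v"
      using h by (auto simp: bij_betw_def inj_on_def)
  qed
  then have "\<exists>c f. proper_colouring G c f"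
    by blast
  then have "\<exists>f. proper_colouring G (chromatic_number G) f"
    unfolding chromatic_number_def by (rule LeastI_ex)
  then obtain f where "proper_colouring G (chromatic_number G) f" ..
  then have "proper_colouring G c f"
    using assms(3) by (auto simp: proper_colouring_def)
  then show ?thesis
    by blast
qed

text \<open>Greedy colouring: after colouring \<open>V - {v}\<close> for a vertex \<open>v\<close>
  of degree at most \<open>d\<close>, one of the \<open>d + 1\<close> colours is absent from the
  neighbours of \<open>v\<close>.\<close>

lemma degenerate_colouring:
  fixes g :: "'e \<Rightarrow> 'v set"
  assumes "finite V" and "finite E" and g: "\<And>e. e \<in> E \<Longrightarrow> card (g e) = 2"
    and "\<And>W. W \<subseteq> V \<Longrightarrow> W \<noteq> {} \<Longrightarrow> \<exists>v\<in>W. card {e \<in> E. g e \<subseteq> W \<and> v \<in> g e} \<le> d"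
  shows "\<exists>f :: 'v \<Rightarrow> nat. (\<forall>v. f v \<le> d) \<and>
    (\<forall>e\<in>E. g e \<subseteq> V \<longrightarrow> (\<forall>u v. g e = {u, v} \<longrightarrow> f u \<noteq> f v))"
  using assms(1,4)
proof (induction V rule: finite_psubset_induct)
  case (psubset V)
  show ?case
  proof (cases "V = {}")
    case True
    have "g e \<noteq> {}" if "e \<in> E" for e
      using g[OF that] by auto
    with True show ?thesis
      by (intro exI[of _ "\<lambda>_. 0"]) auto
  next
    case False
    then obtain v where v: "v \<in> V" "card {e \<in> E. g e \<subseteq> V \<and> v \<in> g e} \<le> d"
      using psubset.prems[of V] by auto
    define N where "N = {e \<in> E. g e \<subseteq> V \<and> v \<in> g e}"
    have "V - {v} \<subset> V"
      using v(1) by blast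
    note IH = psubset.IH[OF this]
    have "\<exists>w\<in>W. card {e \<in> E. g e \<subseteq> W \<and> w \<in> g e} \<le> d" if "W \<subseteq> V - {v}" "W \<noteq> {}" for W
      using psubset.prems[of W] that by blast
    from IH[OF this] obtain f :: "'v \<Rightarrow> nat" where f: "\<And>w. f w \<le> d"
      "\<And>e u w. e \<in> E \<Longrightarrow> g e \<subseteq> V - {v} \<Longrightarrow> g e = {u, w} \<Longrightarrow> f u \<noteq> f w"
      by blast
    let ?U = "\<Union>e\<in>N. g e - {v}"
    have U: "finite ?U \<and> card ?U \<le> card N"
    proof -
      have finN: "finite N"
        using assms(2) by (simp add: N_def)
      have ge: "card (g e - {v}) = 1" "finite (g e - {v})" if "e \<in> N" for e
        using g[of e] that card_ge_0_finite[of "g e"] by (auto simp: N_def)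
      have "card ?U \<le> (\<Sum>e\<in>N. card (g e - {v}))"
        using finN by (rule card_UN_le)
      then show ?thesis
        using finN ge by simp
    qed
    have "card (f ` ?U) \<le> card N"
      using U card_image_le[of ?U f] by linarith
    also have "\<dots> < card {..d}"
      using v(2) by (simp add: N_def)
    finally have "\<not> {..d} \<subseteq> f ` ?U"
      using U card_mono[of "f ` ?U" "{..d}"] by auto
    then obtain c where c: "c \<le> d" "c \<notin> f ` ?U"
      by auto
    have proper: "(f(v := c)) u \<noteq> (f(v := c)) w" if e: "e \<in> E" "g e \<subseteq> V" "g e = {u, w}" for e u w
    proof -
      have uw: "u \<noteq> w"
        using g[OF e(1)] e(3) by auto
      show ?thesis
      proof (cases "v \<in> g e")
        case True
        then have "e \<in> N"
          using e by (simp add: N_def)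
        with c(2) e(3) have "\<And>z. z \<in> {u, w} - {v} \<Longrightarrow> f z \<noteq> c"
          by blast
        with True uw e(3) show ?thesis
          by fastforce
      next
        case False
        with e f(2)[OF e(1) _ e(3)] show ?thesis
          by auto
      qed
    qed
    show ?thesis
    proof (intro exI[of _ "f(v := c)"] conjI allI ballI impI)
      show "(f(v := c)) w \<le> d" for w
        using f(1) c(1) by simp
    qed (rule proper)
  qed
qed

text \<open>The degrees within \<open>W\<close> sum to twice the number of edges within
  \<open>W\<close>, so they cannot all exceed \<open>d\<close>.\<close>

lemma exists_small_degree:
  assumes "finite W" and "W \<noteq> {}" and "finite F" and "\<And>e. e \<in> F \<Longrightarrow> card (g e) = 2"
    and card: "2 * card {e \<in> F. g e \<subseteq> W} < Suc d * card W"
  shows "\<exists>v\<in>W. card {e \<in> F. g e \<subseteq> W \<and> v \<in> g e} \<le> d"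
proof (rule ccontr)
  assume "\<not> ?thesis"
  then have "Suc d * card W \<le> (\<Sum>v\<in>W. card {e \<in> {e \<in> F. g e \<subseteq> W}. v \<in> g e})"
    using sum_bounded_below[of W "Suc d" "\<lambda>v. card {e \<in> {e \<in> F. g e \<subseteq> W}. v \<in> g e}"]
    by (auto simp: mult.commute conj_assoc not_le Suc_le_eq)
  also have "\<dots> = 2 * card {e \<in> F. g e \<subseteq> W}"
  proof (intro sum_multicount ballI)
    fix e assume e: "e \<in> {e \<in> F. g e \<subseteq> W}"
    then have "{v \<in> W. v \<in> g e} = g e"
      by auto
    with e assms(4) show "card {v \<in> W. v \<in> g e} = 2"
      by simp
  qed (use assms in auto)
  finally show False
    using card by simp
qed

lemma has_bipartite_modulo_regular_subgraph_mono:
  assumes "subgraph G' G" and "has_bipartite_modulo_regular_subgraph k G'"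
  shows "has_bipartite_modulo_regular_subgraph k G"
proof -
  have "subgraph H G" if "subgraph H G'" for H
    using assms(1) that by (auto simp: subgraph_def)
  with assms(2) show ?thesis
    unfolding has_bipartite_modulo_regular_subgraph_def by blast
qed

text \<open>Induction on the number of vertices: if a proper vertex subset already induces too many
  edges, pass to it. Otherwise surplus edges are discarded, and the rest is sparse enough to be
  coloured greedily.\<close>

lemma bipartite_modulo_regular_of_many_edges:
  fixes G :: "('v, 'e) mgraph"
  assumes q: "primepow q" and k: "0 < k" "k \<le> q"
    and "graph G" and "loopless G"
    and "real (card (edges G)) > (2 * real q - 5 / 2) * (real (order G) - 1)"
  shows "has_bipartite_modulo_regular_subgraph k G"
  using assms(4-6)
proof (induction "card (vertices G)" arbitrary: G rule: less_induct)
  case less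
  let ?b = "2 * real q - 5 / 2" and ?E = "edges G" and ?V = "vertices G" and ?g = "ends G"
  define G' where "G' W F = \<lparr>vertices = W, edges = F, ends = ?g\<rparr>" for W F
  have fin: "finite ?E" "finite ?V" "?V \<noteq> {}"
    using less.prems(1) by (auto simp: graph_def)
  have q2: "q \<ge> 2"
    using primepow_gt_Suc_0[OF q] by simp
  have sub: "subgraph (G' W F) G" and loopless: "loopless (G' W F)"
    if "W \<subseteq> ?V" "W \<noteq> {}" "F \<subseteq> ?E" "\<And>e. e \<in> F \<Longrightarrow> ?g e \<subseteq> W" for W F
  proof -
    have "finite W" "finite F"
      using that(1,3) fin finite_subset by blast+
    moreover have "card (?g e) = 2" if "e \<in> F" for e
      using loopless_card_ends[OF less.prems(1,2)] that \<open>F \<subseteq> ?E\<close> by blast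
    ultimately show "subgraph (G' W F) G" "loopless (G' W F)"
      using that by (auto simp: subgraph_def graph_def G'_def loopless_def)
  qed
  show ?case
  proof (cases "\<exists>W\<subset>?V. W \<noteq> {} \<and> real (card {e \<in> ?E. ?g e \<subseteq> W}) > ?b * (real (card W) - 1)")
    case True
    then obtain W where W: "W \<subset> ?V" "W \<noteq> {}"
      "real (card {e \<in> ?E. ?g e \<subseteq> W}) > ?b * (real (card W) - 1)"
      by blast
    let ?H = "G' W {e \<in> ?E. ?g e \<subseteq> W}"
    have H: "subgraph ?H G" "loopless ?H"
      using W by (auto intro!: sub loopless)
    have "has_bipartite_modulo_regular_subgraph k ?H"
    proof (rule less.hyps)
      show "card (vertices ?H) < card ?V"
        using W(1) fin(2) by (simp add: G'_def psubset_card_mono)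
      show "graph ?H"
        using H(1) by (simp add: subgraph_def)
    qed (use W(3) H(2) in \<open>simp_all add: G'_def order_def\<close>)
    then show ?thesis
      by (rule has_bipartite_modulo_regular_subgraph_mono[OF H(1)])
  next
    case False
    \<comment> \<open>The least integer above the threshold.\<close>
    define m where "m = Suc (nat \<lfloor>?b * (real (card ?V) - 1)\<rfloor>)"
    have "card ?V \<ge> 1"
      using fin by (simp add: Suc_le_eq card_gt_0_iff)
    then have nonneg: "?b * (real (card ?V) - 1) \<ge> 0"
      using q2 by (intro mult_nonneg_nonneg) auto
    have m: "?b * (real (card ?V) - 1) < real m" "real m \<le> ?b * (real (card ?V) - 1) + 1"
      using nonneg unfolding m_def by linarith+
    have "m \<le> card ?E"
      using less.prems(3) nonneg unfolding m_def order_def by linarith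
    then obtain F where F: "F \<subseteq> ?E" "card F = m"
      by (meson obtain_subset_with_card_n)
    have finF: "finite F"
      using F(1) fin(1) finite_subset by blast
    \<comment> \<open>The summand 1 covers the rounding in \<open>m\<close> when \<open>W\<close> is
      the whole vertex set; proper subsets satisfy the bound without it.\<close>
    have dens: "real (card {e \<in> F. ?g e \<subseteq> W}) \<le> ?b * (real (card W) - 1) + 1"
      if W: "W \<subseteq> ?V" "W \<noteq> {}" for W
    proof (cases "W = ?V")
      case True
      have "card {e \<in> F. ?g e \<subseteq> W} \<le> m"
        using card_mono[OF finF, of "{e \<in> F. ?g e \<subseteq> W}"] F(2) by auto
      then have "real (card {e \<in> F. ?g e \<subseteq> W}) \<le> real m"
        by (simp only: of_nat_le_iff)
      also note m(2)
      finally show ?thesis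
        using True by simp
    next
      case neq: False
      have "card {e \<in> F. ?g e \<subseteq> W} \<le> card {e \<in> ?E. ?g e \<subseteq> W}"
        using F(1) fin(1) by (intro card_mono) auto
      then have "real (card {e \<in> F. ?g e \<subseteq> W}) \<le> real (card {e \<in> ?E. ?g e \<subseteq> W})"
        by (simp only: of_nat_le_iff)
      also have "\<dots> \<le> ?b * (real (card W) - 1)"
        using False W neq unfolding not_less[symmetric] by blast
      finally show ?thesis
        by (rule order_trans) simp
    qed
    have card2: "card (?g e) = 2" if "e \<in> F" for e
      using loopless_card_ends[OF less.prems(1,2)] that F(1) by blast
    have small: "\<exists>v\<in>W. card {e \<in> F. ?g e \<subseteq> W \<and> v \<in> ?g e} \<le> 4 * q - 6"
      if W: "W \<subseteq> ?V" "W \<noteq> {}" for W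
    proof (rule exists_small_degree[OF _ W(2) finF card2])
      show "finite W"
        using W(1) fin(2) finite_subset by blast
      have "2 * real (card {e \<in> F. ?g e \<subseteq> W}) \<le> (4 * real q - 5) * (real (card W) - 1) + 2"
        using dens[OF W] by (simp add: field_simps)
      \<comment> \<open>Strict because \<open>4 * q - 5\<close> is at least 3, which exceeds the
        summand 2.\<close>
      also have "\<dots> < (4 * real q - 5) * real (card W)"
        using q2 by (simp add: algebra_simps)
      also have "4 * real q - 5 = real (Suc (4 * q - 6))"
        using q2 by (simp add: of_nat_diff)
      finally have "real (2 * card {e \<in> F. ?g e \<subseteq> W}) < real (Suc (4 * q - 6) * card W)"
        by (simp only: of_nat_mult of_nat_numeral)
      then show "2 * card {e \<in> F. ?g e \<subseteq> W} < Suc (4 * q - 6) * card W"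
        by (simp only: of_nat_less_iff)
    qed
    have "\<exists>f :: 'v \<Rightarrow> nat. (\<forall>v. f v \<le> 4 * q - 6) \<and>
        (\<forall>e\<in>F. ?g e \<subseteq> ?V \<longrightarrow> (\<forall>u v. ?g e = {u, v} \<longrightarrow> f u \<noteq> f v))"
      using fin(2) finF card2 small by (rule degenerate_colouring)
    then obtain f where f: "\<And>v. f v \<le> 4 * q - 6"
      "\<And>e u v. e \<in> F \<Longrightarrow> ?g e \<subseteq> ?V \<Longrightarrow> ?g e = {u, v} \<Longrightarrow> f u \<noteq> f v"
      by blast
    have gV: "?g e \<subseteq> ?V" if "e \<in> F" for e
      using less.prems(1) F(1) that by (auto simp: graph_def)
    have H: "subgraph (G' ?V F) G" "loopless (G' ?V F)"
      using gV F(1) fin(3) by (auto intro!: sub loopless)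
    have "has_bipartite_modulo_regular_subgraph k (G' ?V F)"
    proof (rule bipartite_modulo_regular_of_colouring[OF _ H(2) _ _ q k])
      show "graph (G' ?V F)"
        using H(1) by (simp add: subgraph_def)
      \<comment> \<open>The \<open>4 * q - 5\<close> colours are padded to \<open>2 * t\<close> with
        \<open>t = 2 * (q - 1)\<close>. For this \<open>t\<close> the coefficient
        \<open>(2 - 1 / t) * (q - 1)\<close> is exactly \<open>2 * q - 5 / 2\<close>.\<close>
      have "f v < 2 * (2 * (q - 1))" for v
        using f(1)[of v] q2 by linarith
      then show "proper_colouring (G' ?V F) (2 * (2 * (q - 1))) f"
        using f(2)[OF _ gV] by (auto simp: proper_colouring_def G'_def)
      show "2 * (q - 1) > 0"
        using q2 by simp
      have "(2 - 1 / real (2 * (q - 1))) * (real q - 1) = ?b"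
        using q2 by (simp add: of_nat_diff field_simps)
      then show "(2 - 1 / real (2 * (q - 1))) * (real q - 1) * (real (order (G' ?V F)) - 1)
          < real (card (edges (G' ?V F)))"
        using m(1) F(2) by (simp add: G'_def order_def)
    qed
    then show ?thesis
      by (rule has_bipartite_modulo_regular_subgraph_mono[OF H(1)])
  qed
qed

section \<open>Bounding the least prime power, and the final theorem\<close>

lemma primepow_two_power: "j > 0 \<Longrightarrow> primepow ((2::nat) ^ j)"
  unfolding primepow_def using two_is_prime_nat by blast

lemma least_primepow_ge:
  "primepow (least_primepow_ge k)" "k \<le> least_primepow_ge k"
proof -
  have "k \<le> 2 ^ Suc k"
    by (metis Suc_leD less_exp less_imp_le_nat)
  then have "primepow (2 ^ Suc k :: nat) \<and> k \<le> 2 ^ Suc k"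
    using primepow_two_power by blast
  then have "primepow (least_primepow_ge k) \<and> k \<le> least_primepow_ge k"
    unfolding least_primepow_ge_def by (rule LeastI)
  then show "primepow (least_primepow_ge k)" "k \<le> least_primepow_ge k"
    by auto
qed

text \<open>The least power of two that is at least \<open>k\<close> is twice a power of two below
  \<open>k\<close>, hence at most \<open>2 * (k - 1)\<close>.\<close>

lemma least_primepow_ge_le:
  assumes "k \<ge> 2"
  shows "least_primepow_ge k \<le> 2 * k - 2"
proof -
  obtain j where j: "2 ^ j < k" "k \<le> 2 ^ (j + 1)"
    using ex_power_ivl2[of 2 k] assms by auto
  have "least_primepow_ge k \<le> 2 ^ (j + 1)"
    unfolding least_primepow_ge_def using j(2) primepow_two_power[of "j + 1"] by (intro Least_le) auto
  with j(1) show ?thesis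
    by simp
qed

text \<open>Treats \<open>k = 1\<close> in the third claim, where
  \<open>least_primepow_ge 1 = 2\<close> exceeds \<open>2 * k - 2\<close>. A single edge
  serves.\<close>

lemma bipartite_modulo_one_regular:
  assumes "graph G" and "loopless G" and "edges G \<noteq> {}"
  shows "has_bipartite_modulo_regular_subgraph 1 G"
proof -
  obtain e where e: "e \<in> edges G"
    using assms by blast
  then obtain u v where uv: "ends G e = {u, v}" "u \<noteq> v"
    using loopless_card_ends[OF assms(1,2)] by (meson card_2_iff)
  show ?thesis
    by (rule has_bipartite_modulo_regular_subgraphI[OF assms(1), of "{e}" "\<lambda>_. u" "\<lambda>_. v"])
      (use e uv in auto)
qed

text \<open>For \<open>k = 1\<close> and order at least 2 the bound of the third claim is negative,
  so edgeless graphs satisfy it, yet they have no subgraph with all degrees positive. Hence the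
  condition \<open>edges G \<noteq> {}\<close> there.\<close>

theorem theorem6p8:
  fixes k :: nat and G :: "('v, 'e) mgraph"
  assumes "k > 0" and "graph G" and "loopless G"
  shows "(\<forall>t::nat. t > 0 \<longrightarrow> chromatic_number G \<le> 2 * t \<longrightarrow>
            real (card (edges G)) >
              (2 - 1 / real t) * (real (least_primepow_ge k) - 1) * (real (order G) - 1) \<longrightarrow>
            has_bipartite_modulo_regular_subgraph k G) \<and>
         (real (card (edges G)) > (2 * real (least_primepow_ge k) - 5 / 2) * (real (order G) - 1) \<longrightarrow>
            has_bipartite_modulo_regular_subgraph k G) \<and>
         (edges G \<noteq> {} \<longrightarrow>
            real (card (edges G)) > (4 * real k - 6) * (real (order G) - 1) \<longrightarrow>
            has_bipartite_modulo_regular_subgraph k G)"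
proof (intro conjI allI impI)
  note q = least_primepow_ge[of k]
  show "has_bipartite_modulo_regular_subgraph k G"
    if "t > 0" "chromatic_number G \<le> 2 * t" "real (card (edges G)) >
      (2 - 1 / real t) * (real (least_primepow_ge k) - 1) * (real (order G) - 1)" for t
    using proper_colouring_of_chromatic_number_le[OF assms(2,3) that(2)]
      bipartite_modulo_regular_of_colouring[OF assms(2,3) _ that(1) q(1) assms(1) q(2) that(3)]
    by blast
  show many: "has_bipartite_modulo_regular_subgraph k G"
    if "real (card (edges G)) > (2 * real (least_primepow_ge k) - 5 / 2) * (real (order G) - 1)"
    using bipartite_modulo_regular_of_many_edges[OF q(1) assms(1) q(2) assms(2,3) that] .
  show "has_bipartite_modulo_regular_subgraph k G"
    if "edges G \<noteq> {}" "real (card (edges G)) > (4 * real k - 6) * (real (order G) - 1)"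
  proof (cases "k = 1")
    case True
    then show ?thesis
      using bipartite_modulo_one_regular[OF assms(2,3) that(1)] by simp
  next
    case False
    with assms(1) have k: "k \<ge> 2"
      by simp
    \<comment> \<open>This bounds the coefficient of the second claim by
      \<open>4 * k - 13 / 2\<close>, which is below \<open>4 * k - 6\<close>.\<close>
    have "real (least_primepow_ge k) \<le> real (2 * k - 2)"
      using least_primepow_ge_le[OF k] by (simp only: of_nat_le_iff)
    then have "2 * real (least_primepow_ge k) - 5 / 2 \<le> 4 * real k - 6"
      using k by (simp add: of_nat_diff)
    moreover have "order G \<ge> 1"
      using assms(2) by (simp add: order_def graph_def Suc_le_eq card_gt_0_iff)
    ultimately have "(2 * real (least_primepow_ge k) - 5 / 2) * (real (order G) - 1) \<le>
        (4 * real k - 6) * (real (order G) - 1)"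
      by (intro mult_right_mono) auto
    with that(2) show ?thesis
      by (intro many) linarith
  qed
qed

end
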